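(* Let $G=(R,C,K)$ be an EM-grid with $1\le K\le C$, and let $\overline{R}=\lceil R/2\rceil$, $\overline{C}=\lceil C/2\rceil$, $\overline{K}=\lceil K/2\rceil$. For $i\in\{1,\dots,C\}$ let $\overline{\mathcal{C}}(i)=\mathcal{C}(G,(\overline{R},i))$, where $\mathcal{C}(G,u)=2\sum_{v\in G}d(v,u)$. Let $c\in\{\overline{K},\dots,K\}$ satisfy $\overline{\mathcal{C}}(c)=\min_{i\in[\overline{K},K]}\overline{\mathcal{C}}(i)$, and let $c'\in\{\overline{K},\dots,\overline{C}\}$ satisfy $\overline{\mathcal{C}}(c')=\min_{i\in[\overline{K},\overline{C}]}\overline{\mathcal{C}}(i)$. Define $$c^*=\begin{cases} c & \text{if } K\le\overline{C} \text{ and } \overline{\mathcal{C}}(c)<\overline{\mathcal{C}}(\overline{C}),\\ \overline{C} & \text{if } K\le\overline{C} \text{ and } \overline{\mathcal{C}}(c)\ge\overline{\mathcal{C}}(\overline{C}),\\ c' & \text{otherwise.}\end{cases}$$ Then $u^*=(\overline{R},c^* )$ is a median of $G$, i.e., $\mathcal{C}(G,u^* )=\min_{u\in G}\mathcal{C}(G,u)$.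
   Context: The EM-grid $G=(R,C,K)$ has vertex set $\{1,\dots,R\}\times\{1,\dots,C\}$ (pairs (row, column)); Euclidean part $E=\{1,\dots,R\}\times\{1,\dots,K\}$, border $B=\{1,\dots,R\}\times\{K\}\subseteq E$, Manhattan part $M=\{1,\dots,R\}\times\{K+1,\dots,C\}$. With $d_E(u,v)=\sqrt{(r_u-r_v)^2+(c_u-c_v)^2}$ and $d_M(u,v)=|r_u-r_v|+|c_u-c_v|$: $d(u,v)=d_E(u,v)$ if $u,v\in E$; $d(u,v)=d_M(u,v)$ if $u,v\in M\cup B$; $d(u,v)=d_E(u,h)+d_M(h,v)$ with $h=(r_v,K)$ if $u\in E,v\in M$; $d(u,v)=d_M(u,h)+d_E(h,v)$ with $h=(r_u,K)$ if $u\in M,v\in E$. A median of $G$ is a vertex minimizing $\mathcal{C}(G,\cdot)$ over $G$. *)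

theory Defs
  imports Complex_Main
begin

text \<open>
  A vertex is a pair (row, column), both counted from 1.  The grid \<open>(R, C, K)\<close> is passed as three
  natural numbers; \<open>1 \<le> R\<close> and \<open>1 \<le> K \<le> C\<close> are assumed where they are needed.
\<close>

type_synonym vertex = "nat \<times> nat"

definition grid_vertices :: "nat \<Rightarrow> nat \<Rightarrow> vertex set" where
  "grid_vertices R C = {1..R} \<times> {1..C}"

definition euclid_part :: "nat \<Rightarrow> nat \<Rightarrow> vertex set" where
  "euclid_part R K = {1..R} \<times> {1..K}"

definition border :: "nat \<Rightarrow> nat \<Rightarrow> vertex set" where
  "border R K = {1..R} \<times> {K}"

definition manhattan_part :: "nat \<Rightarrow> nat \<Rightarrow> nat \<Rightarrow> vertex set" where
  "manhattan_part R C K = {1..R} \<times> {K + 1..C}"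

definition dist_E :: "vertex \<Rightarrow> vertex \<Rightarrow> real" where
  "dist_E u v = sqrt ((real (fst u) - real (fst v))\<^sup>2 + (real (snd u) - real (snd v))\<^sup>2)"

definition dist_M :: "vertex \<Rightarrow> vertex \<Rightarrow> real" where
  "dist_M u v = \<bar>real (fst u) - real (fst v)\<bar> + \<bar>real (snd u) - real (snd v)\<bar>"

text \<open>
  On grid vertices the last branch is exactly the case where \<open>u\<close> is in the Manhattan part and
  \<open>v\<close> in the Euclidean part.  The branches overlap only where they agree (pairs within the border,
  pairs of a border and a Manhattan vertex), so their order does not matter.
\<close>

definition dist_EM :: "nat \<Rightarrow> nat \<Rightarrow> nat \<Rightarrow> vertex \<Rightarrow> vertex \<Rightarrow> real" where
  "dist_EM R C K u v =
    (if u \<in> euclid_part R K \<and> v \<in> euclid_part R K then dist_E u v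
     else if u \<in> manhattan_part R C K \<union> border R K \<and> v \<in> manhattan_part R C K \<union> border R K
       then dist_M u v
     else if u \<in> euclid_part R K \<and> v \<in> manhattan_part R C K
       then (let h = (fst v, K) in dist_E u h + dist_M h v)
     else (let h = (fst u, K) in dist_M u h + dist_E h v))"

definition grid_cost :: "nat \<Rightarrow> nat \<Rightarrow> nat \<Rightarrow> vertex \<Rightarrow> real" where
  "grid_cost R C K u = 2 * (\<Sum>v\<in>grid_vertices R C. dist_EM R C K v u)"

definition is_median :: "nat \<Rightarrow> nat \<Rightarrow> nat \<Rightarrow> vertex \<Rightarrow> bool" where
  "is_median R C K u \<longleftrightarrow>
    u \<in> grid_vertices R C \<and>
    grid_cost R C K u = Min (grid_cost R C K ` grid_vertices R C)"

end

theory Submission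
  imports Defs
begin

text \<open>
  The distance between \<open>(r', k)\<close> and \<open>(r, j)\<close> is a nondecreasing function of \<open>\<bar>r' - r\<bar>\<close> for fixed
  columns, so in every column the middle row is optimal.  Within the middle row, the cost of
  column \<open>j\<close> splits over the row offsets \<open>x\<close>.  Passing from \<open>j\<close> to \<open>j + 1\<close> changes the contribution of
  an offset in the Euclidean part by \<open>f j - f (K - j) - (C - K) * (f (K - j) - f (K - j - 1))\<close> with
  \<open>f t = sqrt (x\<^sup>2 + t\<^sup>2)\<close>.  This is at most 0 when \<open>2 * j \<le> K\<close>, and at least 0 when \<open>2 * j \<ge> C\<close>
  because \<open>f\<close> is convex and \<open>C - K \<le> j - (K - j)\<close>.  To the right of the border the cost is, up to a
  constant, the one-dimensional Manhattan cost, which is unimodal around the middle column.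
\<close>

section \<open>Monotone sequences and costs on a line\<close>

lemma Suc_mono_on_le:
  fixes F :: "nat \<Rightarrow> 'a::order"
  assumes "\<And>i. \<lbrakk>a \<le> i; i < b\<rbrakk> \<Longrightarrow> F i \<le> F (Suc i)" "a \<le> i" "i \<le> j" "j \<le> b"
  shows "F i \<le> F j"
  using assms(3,4)
proof (induction j rule: dec_induct)
  case base
  show ?case by simp
next
  case (step n)
  then have "F i \<le> F n" "F n \<le> F (Suc n)"
    using assms(1)[of n] assms(2) by auto
  then show ?case by (rule order_trans)
qed

lemma Suc_antimono_on_le:
  fixes F :: "nat \<Rightarrow> 'a::order"
  assumes "\<And>i. \<lbrakk>a \<le> i; i < b\<rbrakk> \<Longrightarrow> F (Suc i) \<le> F i" "a \<le> i" "i \<le> j" "j \<le> b"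
  shows "F j \<le> F i"
  using assms(3,4)
proof (induction j rule: dec_induct)
  case base
  show ?case by simp
next
  case (step n)
  then have "F n \<le> F i" "F (Suc n) \<le> F n"
    using assms(1)[of n] assms(2) by auto
  then show ?case using order_trans by blast
qed

text \<open>Serves both directions of the grid: across rows \<open>f\<close> is the distance profile
  between two fixed columns, along a row it is the Euclidean norm at fixed offset or the
  identity.\<close>

definition line_cost :: "(real \<Rightarrow> real) \<Rightarrow> nat \<Rightarrow> nat \<Rightarrow> real" where
  "line_cost f n i = (\<Sum>k=1..n. f \<bar>real k - real i\<bar>)"

text \<open>The differences \<open>k - i\<close> fill an integer interval. Moving to
  \<open>Suc i\<close> shifts it down by one, so \<open>- i\<close> enters and \<open>n - i\<close>
  leaves.\<close>

lemma line_cost_Suc: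
  "line_cost f n (Suc i) = line_cost f n i + f (real i) - f \<bar>real n - real i\<bar>"
  unfolding line_cost_def by (induction n) (auto simp: algebra_simps)

lemma line_cost_Suc_le:
  assumes "mono_on {0..} f" "2 * i \<le> n"
  shows "line_cost f n (Suc i) \<le> line_cost f n i"
  using mono_onD[OF assms(1), of "real i" "\<bar>real n - real i\<bar>"] assms(2)
  by (simp add: line_cost_Suc)

lemma line_cost_le_Suc:
  assumes "mono_on {0..} f" "n \<le> 2 * i"
  shows "line_cost f n i \<le> line_cost f n (Suc i)"
  using mono_onD[OF assms(1), of "\<bar>real n - real i\<bar>" "real i"] assms(2)
  by (simp add: line_cost_Suc)

lemma line_cost_middle_le:
  assumes "mono_on {0..} f"
  shows "line_cost f n ((n + 1) div 2) \<le> line_cost f n i"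
proof (cases "i \<le> (n + 1) div 2")
  case True
  show ?thesis
    by (rule Suc_antimono_on_le[of 0 "(n + 1) div 2"]) (use True assms line_cost_Suc_le in auto)
next
  case False
  show ?thesis
    by (rule Suc_mono_on_le[of "(n + 1) div 2" i]) (use False assms line_cost_le_Suc in auto)
qed

section \<open>Convexity of the Euclidean norm along a row\<close>

lemma mono_on_sqrt_sum_squares: "mono_on {0..} (\<lambda>t. sqrt (x\<^sup>2 + t\<^sup>2))"
  by (auto intro!: mono_onI power_mono)

text \<open>Triangle inequality for the vectors \<open>(x, t)\<close> and \<open>(x, t + 2)\<close>,
  whose sum is twice \<open>(x, t + 1)\<close>.\<close>

lemma sqrt_sum_squares_midpoint:
  fixes x t :: real
  shows "2 * sqrt (x\<^sup>2 + (t + 1)\<^sup>2) \<le> sqrt (x\<^sup>2 + t\<^sup>2) + sqrt (x\<^sup>2 + (t + 2)\<^sup>2)"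
proof -
  have "2 * sqrt (x\<^sup>2 + (t + 1)\<^sup>2) = sqrt (2\<^sup>2 * (x\<^sup>2 + (t + 1)\<^sup>2))"
    by (simp only: real_sqrt_mult real_sqrt_abs abs_numeral)
  also have "2\<^sup>2 * (x\<^sup>2 + (t + 1)\<^sup>2) = (x + x)\<^sup>2 + (t + (t + 2))\<^sup>2"
    by (simp add: power2_eq_square algebra_simps)
  finally show ?thesis
    using real_sqrt_sum_squares_triangle_ineq[of x x t "t + 2"] by simp
qed

text \<open>Convexity makes the increments nondecreasing, so each of the \<open>d\<close> increments
  from \<open>Suc n\<close> on is at least the one at \<open>n\<close>.\<close>

lemma convex_seq_increment:
  fixes f :: "nat \<Rightarrow> real"
  assumes "\<And>i. 2 * f (Suc i) \<le> f i + f (Suc (Suc i))"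
  shows "real d * (f (Suc n) - f n) \<le> f (Suc n + d) - f (Suc n)"
proof (induction d)
  case (Suc d)
  have "f (Suc n) - f n \<le> f (Suc (n + Suc d)) - f (n + Suc d)"
    by (rule Suc_mono_on_le[where a = n and b = "n + Suc d" and F = "\<lambda>i. f (Suc i) - f i"])
      (use assms in \<open>force simp: algebra_simps\<close>)+
  with Suc show ?case by (simp add: algebra_simps)
qed simp

section \<open>Reduction to the middle row\<close>

text \<open>
  The distance between \<open>(r', k)\<close> and \<open>(r, j)\<close> in terms of \<open>x = \<bar>r' - r\<bar>\<close>; at \<open>j = K\<close> both branches of
  the outer case distinction agree.
\<close>

definition offset_dist :: "nat \<Rightarrow> nat \<Rightarrow> nat \<Rightarrow> real \<Rightarrow> real" where
  "offset_dist K j k x =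
    (if j \<le> K
     then (if k \<le> K then sqrt (x\<^sup>2 + (real k - real j)\<^sup>2)
           else sqrt (x\<^sup>2 + (real K - real j)\<^sup>2) + (real k - real K))
     else (if k \<le> K then sqrt (x\<^sup>2 + (real K - real k)\<^sup>2) + (real j - real K)
           else x + \<bar>real k - real j\<bar>))"

lemma dist_EM_eq_offset_dist:
  assumes "r' \<in> {1..R}" "r \<in> {1..R}" "k \<in> {1..C}" "j \<in> {1..C}"
  shows "dist_EM R C K (r', k) (r, j) = offset_dist K j k \<bar>real r' - real r\<bar>"
  using assms
  by (auto simp: dist_EM_def offset_dist_def euclid_part_def manhattan_part_def border_def
      dist_E_def dist_M_def Let_def power2_commute)

lemma mono_on_offset_dist: "mono_on {0..} (offset_dist K j k)"
  by (auto simp: offset_dist_def intro!: mono_onI power_mono)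

lemma grid_cost_eq_line_cost:
  assumes "r \<in> {1..R}" "j \<in> {1..C}"
  shows "grid_cost R C K (r, j) = 2 * (\<Sum>k=1..C. line_cost (offset_dist K j k) R r)"
proof -
  have "(\<Sum>v\<in>grid_vertices R C. dist_EM R C K v (r, j)) =
      (\<Sum>r'=1..R. \<Sum>k=1..C. dist_EM R C K (r', k) (r, j))"
    by (simp add: grid_vertices_def sum.cartesian_product split_def)
  also have "\<dots> = (\<Sum>r'=1..R. \<Sum>k=1..C. offset_dist K j k \<bar>real r' - real r\<bar>)"
    by (intro sum.cong refl dist_EM_eq_offset_dist assms)
  also have "\<dots> = (\<Sum>k=1..C. line_cost (offset_dist K j k) R r)"
    unfolding line_cost_def by (rule sum.swap)
  finally show ?thesis by (simp add: grid_cost_def)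
qed

text \<open>The middle row minimizes the summand of every vertex column \<open>k\<close> separately,
  hence also their sum.\<close>

lemma grid_cost_middle_row_le:
  assumes "r \<in> {1..R}" "j \<in> {1..C}"
  shows "grid_cost R C K ((R + 1) div 2, j) \<le> grid_cost R C K (r, j)"
proof -
  have "(R + 1) div 2 \<in> {1..R}" using assms by auto
  then show ?thesis
    using assms
    by (simp add: grid_cost_eq_line_cost sum_mono line_cost_middle_le mono_on_offset_dist
        del: One_nat_def)
qed

section \<open>Comparing columns at a fixed row offset\<close>

definition offset_cost :: "nat \<Rightarrow> nat \<Rightarrow> nat \<Rightarrow> real \<Rightarrow> real" where
  "offset_cost C K j x = (\<Sum>k=1..C. offset_dist K j k x)"

lemma grid_cost_mono_offset_cost:
  assumes "r \<in> {1..R}" "i \<in> {1..C}" "j \<in> {1..C}"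
    and "\<And>x. 0 \<le> x \<Longrightarrow> offset_cost C K i x \<le> offset_cost C K j x"
  shows "grid_cost R C K (r, i) \<le> grid_cost R C K (r, j)"
proof -
  have "grid_cost R C K (r, l) = 2 * (\<Sum>r'=1..R. offset_cost C K l \<bar>real r' - real r\<bar>)"
    if "l \<in> {1..C}" for l
    unfolding grid_cost_eq_line_cost[OF assms(1) that] line_cost_def offset_cost_def
    by (simp add: sum.swap[of _ "{1..R}"] del: One_nat_def)
  with assms show ?thesis by (simp add: sum_mono del: One_nat_def)
qed

lemma sum_split_border:
  fixes f :: "nat \<Rightarrow> real"
  assumes "K \<le> C"
  shows "(\<Sum>k=1..C. f k) = (\<Sum>k=1..K. f k) + (\<Sum>k=K+1..C. f k)"
  using assms sum.ub_add_nat[of 1 K f "C - K"] by simp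

text \<open>A Manhattan vertex is reached through the border in its own row, so all
  \<open>C - K\<close> of them at this offset share one Euclidean leg.\<close>

lemma offset_cost_euclid:
  assumes "j \<le> K" "K \<le> C"
  shows "offset_cost C K j x = line_cost (\<lambda>t. sqrt (x\<^sup>2 + t\<^sup>2)) K j
    + (real C - real K) * sqrt (x\<^sup>2 + (real (K - j))\<^sup>2) + (\<Sum>k=K+1..C. real k - real K)"
  using assms unfolding offset_cost_def sum_split_border[OF assms(2)] line_cost_def
  by (simp add: offset_dist_def sum.distrib of_nat_diff)

text \<open>Replacing each Euclidean leg by its horizontal extent \<open>K - k\<close> changes the
  cost by an amount free of \<open>j\<close>.\<close>

lemma offset_cost_manhattan:
  assumes "K \<le> j" "K \<le> C" "0 \<le> x"
  shows "offset_cost C K j x = line_cost (\<lambda>t. t) C j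
    + (\<Sum>k=1..K. sqrt (x\<^sup>2 + (real K - real k)\<^sup>2) - (real K - real k)) + (real C - real K) * x"
proof -
  have E: "offset_dist K j k x =
      \<bar>real k - real j\<bar> + (sqrt (x\<^sup>2 + (real K - real k)\<^sup>2) - (real K - real k))"
    if "k \<in> {1..K}" for k
    using that assms by (auto simp: offset_dist_def power2_commute)
  \<comment> \<open>At \<open>j = K\<close> the Euclidean branch applies, and its root collapses to
    \<open>x\<close> because \<open>0 \<le> x\<close>.\<close>
  have M: "offset_dist K j k x = \<bar>real k - real j\<bar> + x" if "k \<in> {K+1..C}" for k
    using that assms by (auto simp: offset_dist_def)
  have "offset_cost C K j x =
      (\<Sum>k=1..K. \<bar>real k - real j\<bar> + (sqrt (x\<^sup>2 + (real K - real k)\<^sup>2) - (real K - real k)))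
      + (\<Sum>k=K+1..C. \<bar>real k - real j\<bar> + x)"
    unfolding offset_cost_def sum_split_border[OF assms(2)]
    by (intro arg_cong2[where f = "(+)"] sum.cong refl E M)
  also have "\<dots> = line_cost (\<lambda>t. t) C j
    + (\<Sum>k=1..K. sqrt (x\<^sup>2 + (real K - real k)\<^sup>2) - (real K - real k)) + (real C - real K) * x"
    using assms(2) unfolding line_cost_def sum_split_border[OF assms(2)] sum.distrib
    by (simp add: of_nat_diff)
  finally show ?thesis .
qed

text \<open>Neither the line cost of the Euclidean columns nor the leg to the border grows.\<close>

lemma offset_cost_Suc_le_euclid:
  assumes "j < K" "2 * j \<le> K" "K \<le> C"
  shows "offset_cost C K (Suc j) x \<le> offset_cost C K j x"
proof -
  have "sqrt (x\<^sup>2 + (real (K - Suc j))\<^sup>2) \<le> sqrt (x\<^sup>2 + (real (K - j))\<^sup>2)"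
    by (intro real_sqrt_le_mono add_left_mono power_mono) auto
  then have "(real C - real K) * sqrt (x\<^sup>2 + (real (K - Suc j))\<^sup>2)
      \<le> (real C - real K) * sqrt (x\<^sup>2 + (real (K - j))\<^sup>2)"
    using assms by (intro mult_left_mono) auto
  then show ?thesis
    using assms line_cost_Suc_le[OF mono_on_sqrt_sum_squares, of j K x]
    by (simp add: offset_cost_euclid)
qed

lemma offset_cost_le_Suc_euclid:
  assumes "j < K" "C \<le> 2 * j" "K \<le> C"
  shows "offset_cost C K j x \<le> offset_cost C K (Suc j) x"
proof -
  define f where "f n = sqrt (x\<^sup>2 + (real n)\<^sup>2)" for n :: nat
  define n where "n = K - Suc j"
  have n: "K - j = Suc n" "real K - real j = real (Suc n)" "Suc n + (2 * j - K) = j"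
    using assms by (auto simp: n_def)
  have "2 * f (Suc i) \<le> f i + f (Suc (Suc i))" for i
    using sqrt_sum_squares_midpoint[of x "real i"] by (simp add: f_def add.commute)
  \<comment> \<open>From \<open>K - j = Suc n\<close>, exactly \<open>2 * j - K\<close> increments
    lead up to \<open>j\<close>, at least one for each of the \<open>C - K\<close> Manhattan
    columns.\<close>
  from convex_seq_increment[of f, OF this, of "2 * j - K" n]
  have "real (2 * j - K) * (f (Suc n) - f n) \<le> f j - f (Suc n)"
    unfolding n .
  moreover have "f n \<le> f (Suc n)"
    unfolding f_def by (intro real_sqrt_le_mono add_left_mono power_mono) auto
  then have "(real C - real K) * (f (Suc n) - f n) \<le> real (2 * j - K) * (f (Suc n) - f n)"
    using assms by (intro mult_right_mono) auto
  ultimately have "(real C - real K) * (f (Suc n) - f n) \<le> f j - f (Suc n)"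
    by linarith
  moreover have "offset_cost C K (Suc j) x - offset_cost C K j x
      = f j - f (Suc n) - (real C - real K) * (f (Suc n) - f n)"
    using assms
    by (simp add: offset_cost_euclid line_cost_Suc n f_def n_def[symmetric] right_diff_distrib)
  ultimately show ?thesis by linarith
qed

theorem theorem2:
  fixes R C K Rbar Cbar Kbar c c' cstar :: nat
    and rowcost :: "nat \<Rightarrow> real"
  assumes "1 \<le> R" and "1 \<le> K" and "K \<le> C"
    and "Rbar = nat \<lceil>real R / 2\<rceil>"
    and "Cbar = nat \<lceil>real C / 2\<rceil>"
    and "Kbar = nat \<lceil>real K / 2\<rceil>"
    and "\<And>i. i \<in> {1..C} \<Longrightarrow> rowcost i = grid_cost R C K (Rbar, i)"
    and "c \<in> {Kbar..K}" and "rowcost c = Min (rowcost ` {Kbar..K})"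
    and "c' \<in> {Kbar..Cbar}" and "rowcost c' = Min (rowcost ` {Kbar..Cbar})"
    and "cstar = (if K \<le> Cbar \<and> rowcost c < rowcost Cbar then c
                  else if K \<le> Cbar \<and> rowcost c \<ge> rowcost Cbar then Cbar
                  else c')"
  shows "is_median R C K (Rbar, cstar)"
proof -
  have half: "nat \<lceil>real n / 2\<rceil> = (n + 1) div 2" for n
    by linarith
  note bars = assms(4-6)[unfolded half]
  have Rbar: "Rbar \<in> {1..R}" and Kbar: "1 \<le> Kbar" "Kbar \<le> K" "Kbar \<le> Cbar" and Cbar: "Cbar \<le> C"
    using assms(1-3) unfolding bars by auto
  have rowcost_mono: "rowcost i \<le> rowcost j"
    if "i \<in> {1..C}" "j \<in> {1..C}" "\<And>x. 0 \<le> x \<Longrightarrow> offset_cost C K i x \<le> offset_cost C K j x" for i j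
    using grid_cost_mono_offset_cost[OF Rbar that] assms(7) that by simp
  have left: "rowcost Kbar \<le> rowcost j" if "1 \<le> j" "j \<le> Kbar" for j
    by (rule Suc_antimono_on_le[of 1 Kbar])
      (use that Kbar bars assms(2,3) in \<open>auto intro!: rowcost_mono offset_cost_Suc_le_euclid\<close>)
  have middle: "rowcost Cbar \<le> rowcost j" if "Cbar \<le> j" "j \<le> K" for j
    by (rule Suc_mono_on_le[of Cbar K])
      (use that Kbar bars assms(2,3) in \<open>auto intro!: rowcost_mono offset_cost_le_Suc_euclid\<close>)
  have right: "rowcost i \<le> rowcost j"
    if "K \<le> i" "K \<le> j" "i \<le> C" "j \<le> C" "line_cost (\<lambda>t. t) C i \<le> line_cost (\<lambda>t. t) C j" for i j
    by (rule rowcost_mono) (use that assms(2,3) in \<open>auto simp: offset_cost_manhattan\<close>)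
  have id_mono: "mono_on {0..} (\<lambda>t::real. t)"
    by (auto intro: mono_onI)
  have right_Cbar: "rowcost Cbar \<le> rowcost j" if "K \<le> Cbar" "K \<le> j" "j \<le> C" for j
    by (rule right) (use that Cbar line_cost_middle_le[OF id_mono, of C j] bars in auto)
  have right_K: "rowcost K \<le> rowcost j" if "Cbar \<le> K" "K \<le> j" "j \<le> C" for j
    by (rule Suc_mono_on_le[of K C])
      (use that bars in \<open>auto intro!: right line_cost_le_Suc id_mono\<close>)
  \<comment> \<open>Between \<open>Kbar\<close> and the smaller of \<open>K\<close> and
    \<open>Cbar\<close> no monotonicity is established; there the minimality of \<open>c\<close> or
    \<open>c'\<close> takes over.\<close>
  have c_le: "rowcost c \<le> rowcost j" if "j \<in> {Kbar..K}" for j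
    unfolding assms(9) using that by simp
  have c'_le: "rowcost c' \<le> rowcost j" if "j \<in> {Kbar..Cbar}" for j
    unfolding assms(11) using that by simp
  have cstar: "cstar \<in> {1..C}"
    using assms(3,8,10,12) Kbar Cbar by (auto split: if_splits)
  have best: "rowcost cstar \<le> rowcost j" if j: "j \<in> {1..C}" for j
  proof (cases "K \<le> Cbar")
    case True
    then have le: "rowcost cstar \<le> rowcost c" "rowcost cstar \<le> rowcost Cbar"
      using assms(12) by auto
    consider "j \<le> Kbar" | "j \<in> {Kbar..K}" | "K \<le> j" by fastforce
    then show ?thesis
    proof cases
      case 1
      then show ?thesis using left[of j] c_le[of Kbar] le Kbar j by simp
    next
      case 2
      then show ?thesis using c_le[of j] le by simp
    next
      case 3
      then show ?thesis using right_Cbar[of j] True le j by simp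
    qed
  next
    case False
    then have [simp]: "cstar = c'" using assms(12) by simp
    consider "j \<le> Kbar" | "j \<in> {Kbar..Cbar}" | "Cbar \<le> j" "j \<le> K" | "K \<le> j" by fastforce
    then show ?thesis
    proof cases
      case 1
      then show ?thesis using left[of j] c'_le[of Kbar] Kbar j by simp
    next
      case 2
      then show ?thesis using c'_le[of j] by simp
    next
      case 3
      then show ?thesis using middle[of j] c'_le[of Cbar] Kbar by simp
    next
      case 4
      \<comment> \<open>The chain runs from \<open>c'\<close> through \<open>Cbar\<close> and the
        border column \<open>K\<close> to \<open>j\<close>.\<close>
      then show ?thesis
        using right_K[of j] middle[of K] c'_le[of Cbar] Kbar False j by simp
    qed
  qed
  have mem: "(Rbar, cstar) \<in> grid_vertices R C"
    using Rbar cstar by (simp add: grid_vertices_def)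
  have "grid_cost R C K (Rbar, cstar) \<le> grid_cost R C K (r, j)"
    if "(r, j) \<in> grid_vertices R C" for r j
    using that best[of j] assms(7) cstar grid_cost_middle_row_le[of r R j C K]
    by (simp add: grid_vertices_def bars)
  then have "grid_cost R C K (Rbar, cstar) = Min (grid_cost R C K ` grid_vertices R C)"
    using mem by (intro Min_eqI[symmetric]) (auto simp: grid_vertices_def)
  with mem show ?thesis by (simp add: is_median_def)
qed

end
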